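(* Let $k\ge 1$ and let a cyclic snake $kC_{10}$ with string $(d_1,d_2,\dots,d_{k-2})$ be given. Suppose one of the following is true: (1) for all $1\le i\le k-2$: $d_i\in\{4,5\}$ if $i$ is odd and $d_i=5$ if $i$ is even; (2) for all $1\le i\le k-2$: $d_i\in\{3,4\}$ if $i$ is odd and $d_i=4$ if $i$ is even; (3) for all $1\le i\le k-2$: $d_i\in\{2,3\}$ if $i$ is odd and $d_i=3$ if $i$ is even; (4) for all $1\le i\le k-2$: $d_i\in\{1,2\}$ if $i$ is odd and $d_i=2$ if $i$ is even. Then this $kC_{10}$ is graceful if $k$ is even and near graceful if $k$ is odd.
   Context: For a graph $G=(V,E)$ with $m$ edges, a map $f:V\to\{0,1,\dots,m\}$ is a graceful labelling if $f$ is injective and the induced edge labelling $g(uv)=|f(u)-f(v)|$ is a bijection from $E$ onto $\{1,2,\dots,m\}$; $G$ is graceful if it has a graceful labelling. A map $f:V\to\{0,1,\dots,m+1\}$ is a near graceful labelling if $f$ is injective and the induced edge labelling $g(uv)=|f(u)-f(v)|$ is a bijection from $E$ onto $A$, where $A$ is $\{1,2,\dots,m-1,m\}$ or $\{1,2,\dots,m-1,m+1\}$; $G$ is near graceful if it has a near graceful labelling. Convention: all near graceful labellings asserted to exist omit both the vertex label $m$ and the edge label $m$, i.e. $f$ takes values in $\{0,1,\dots,m-1,m+1\}$ and $A=\{1,2,\dots,m-1,m+1\}$. $kC_r$ denotes any connected graph with exactly $k$ blocks, each block a cycle $C_r$ of length $r$, whose block-cutpoint graph is a path (so the blocks can be listed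 $B_1,\dots,B_k$ with $B_i$ and $B_{i+1}$ sharing exactly one vertex, which is the $i$-th cut vertex, and the $k-1$ cut vertices are distinct). For $k\ge 3$ its string is $(d_1,\dots,d_{k-2})$, where $d_i$ is the distance between the $i$-th and $(i+1)$-th cut vertices counted from one end of the snake to the other; for $k\in\{1,2\}$ there is no string and conditions on the string are vacuous. *)

theory Defs
  imports Main
begin

text \<open>A graph is a pair of a vertex set and a set of edges, each edge being the set of its
  two ends.\<close>

type_synonym 'a ugraph = "'a set \<times> 'a set set"

abbreviation verts :: "'a ugraph \<Rightarrow> 'a set" where
  "verts \<equiv> fst"

abbreviation edges :: "'a ugraph \<Rightarrow> 'a set set" where
  "edges \<equiv> snd"

definition simple_graph :: "'a ugraph \<Rightarrow> bool" where
  "simple_graph G \<longleftrightarrow>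
     finite (verts G) \<and> edges G \<subseteq> {{u, v} | u v. u \<in> verts G \<and> v \<in> verts G \<and> u \<noteq> v}"

definition adj :: "'a ugraph \<Rightarrow> ('a \<times> 'a) set" where
  "adj G = {(u, v). {u, v} \<in> edges G}"

definition connected_graph :: "'a ugraph \<Rightarrow> bool" where
  "connected_graph G \<longleftrightarrow>
     verts G \<noteq> {} \<and> (\<forall>u\<in>verts G. \<forall>v\<in>verts G. (u, v) \<in> (adj G)\<^sup>*)"

text \<open>The distance is only meaningful for vertices in the same component:
  \<open>(u, v) \<in> adj G ^^ n\<close> says that there is a walk of length \<open>n\<close> from \<open>u\<close> to \<open>v\<close>.\<close>

definition graph_dist :: "'a ugraph \<Rightarrow> 'a \<Rightarrow> 'a \<Rightarrow> nat" where
  "graph_dist G u v = (LEAST n. (u, v) \<in> adj G ^^ n)"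

definition subgraph :: "'a ugraph \<Rightarrow> 'a ugraph \<Rightarrow> bool" where
  "subgraph H G \<longleftrightarrow> simple_graph H \<and> verts H \<subseteq> verts G \<and> edges H \<subseteq> edges G"

definition delete_vertex :: "'a ugraph \<Rightarrow> 'a \<Rightarrow> 'a ugraph" where
  "delete_vertex G v = (verts G - {v}, {e \<in> edges G. v \<notin> e})"

text \<open>A cut vertex separates two other vertices of its component.\<close>

definition cut_vertex :: "'a ugraph \<Rightarrow> 'a \<Rightarrow> bool" where
  "cut_vertex G v \<longleftrightarrow> v \<in> verts G \<and>
     (\<exists>u\<in>verts G - {v}. \<exists>w\<in>verts G - {v}.
        (u, w) \<in> (adj G)\<^sup>* \<and> (u, w) \<notin> (adj (delete_vertex G v))\<^sup>*)"

text \<open>A block is a maximal connected subgraph that has no cut vertex of its own.\<close>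

definition nonseparable :: "'a ugraph \<Rightarrow> bool" where
  "nonseparable H \<longleftrightarrow> connected_graph H \<and> (\<nexists>v. cut_vertex H v)"

definition blocks :: "'a ugraph \<Rightarrow> 'a ugraph set" where
  "blocks G = {B. subgraph B G \<and> nonseparable B \<and>
     (\<forall>H. subgraph H G \<and> nonseparable H \<and> subgraph B H \<longrightarrow> H = B)}"

definition is_cycle :: "nat \<Rightarrow> 'a ugraph \<Rightarrow> bool" where
  "is_cycle r H \<longleftrightarrow> 3 \<le> r \<and>
     (\<exists>vs. distinct vs \<and> length vs = r \<and> verts H = set vs \<and>
        edges H = {{vs ! i, vs ! (Suc i mod r)} | i. i < r})"

definition path_listing :: "'a ugraph \<Rightarrow> 'a list \<Rightarrow> bool" where
  "path_listing H xs \<longleftrightarrow> xs \<noteq> [] \<and> distinct xs \<and> verts H = set xs \<and>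
     edges H = {{xs ! i, xs ! Suc i} | i. Suc i < length xs}"

definition is_path :: "'a ugraph \<Rightarrow> bool" where
  "is_path H \<longleftrightarrow> (\<exists>xs. path_listing H xs)"

definition block_cutpoint_graph :: "'a ugraph \<Rightarrow> ('a ugraph + 'a) ugraph" where
  "block_cutpoint_graph G =
     (Inl ` blocks G \<union> Inr ` {c. cut_vertex G c},
      {{Inl B, Inr c} | B c. B \<in> blocks G \<and> cut_vertex G c \<and> c \<in> verts B})"

definition cyclic_snake :: "nat \<Rightarrow> nat \<Rightarrow> 'a ugraph \<Rightarrow> bool" where
  "cyclic_snake k r G \<longleftrightarrow> simple_graph G \<and> connected_graph G \<and>
     card (blocks G) = k \<and> (\<forall>B\<in>blocks G. is_cycle r B) \<and> is_path (block_cutpoint_graph G)"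

text \<open>\<open>snake_string G ds\<close>: reading the block-cutpoint path from one of its two ends to the
  other, \<open>ds\<close> lists the distances between consecutive cut vertices.  A snake has one string
  for each of the two directions; the string is empty if there are fewer than three blocks.\<close>

definition snake_string :: "'a ugraph \<Rightarrow> nat list \<Rightarrow> bool" where
  "snake_string G ds \<longleftrightarrow>
     (\<exists>xs. path_listing (block_cutpoint_graph G) xs \<and>
        (let cs = [c. Inr c \<leftarrow> xs] in ds = map2 (graph_dist G) cs (tl cs)))"

definition induced_edge_labelling :: "'a ugraph \<Rightarrow> ('a \<Rightarrow> int) \<Rightarrow> ('a set \<Rightarrow> int) \<Rightarrow> bool" where
  "induced_edge_labelling G f g \<longleftrightarrow> (\<forall>u v. {u, v} \<in> edges G \<longrightarrow> g {u, v} = \<bar>f u - f v\<bar>)"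

definition graceful_labelling :: "'a ugraph \<Rightarrow> ('a \<Rightarrow> int) \<Rightarrow> bool" where
  "graceful_labelling G f \<longleftrightarrow>
     (let m = int (card (edges G)) in
        f ` verts G \<subseteq> {0..m} \<and> inj_on f (verts G) \<and>
        (\<exists>g. induced_edge_labelling G f g \<and> bij_betw g (edges G) {1..m}))"

definition graceful :: "'a ugraph \<Rightarrow> bool" where
  "graceful G \<longleftrightarrow> (\<exists>f. graceful_labelling G f)"

definition near_graceful_labelling :: "'a ugraph \<Rightarrow> ('a \<Rightarrow> int) \<Rightarrow> bool" where
  "near_graceful_labelling G f \<longleftrightarrow>
     (let m = int (card (edges G)) in
        f ` verts G \<subseteq> {0..m + 1} \<and> inj_on f (verts G) \<and>
        (\<exists>g A. A \<in> {{1..m}, {1..m - 1} \<union> {m + 1}} \<and>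
           induced_edge_labelling G f g \<and> bij_betw g (edges G) A))"

text \<open>By convention, the near graceful labellings that are asserted to exist use neither the
  vertex label \<open>m\<close> nor the edge label \<open>m\<close>, where \<open>m\<close> is the number of edges.\<close>

definition omits_m :: "'a ugraph \<Rightarrow> ('a \<Rightarrow> int) \<Rightarrow> bool" where
  "omits_m G f \<longleftrightarrow>
     (let m = int (card (edges G)) in
        m \<notin> f ` verts G \<and> (\<forall>u v. {u, v} \<in> edges G \<longrightarrow> \<bar>f u - f v\<bar> \<noteq> m))"

definition near_graceful :: "'a ugraph \<Rightarrow> bool" where
  "near_graceful G \<longleftrightarrow> (\<exists>f. near_graceful_labelling G f \<and> omits_m G f)"

end

theory Submission imports Defs
begin

text \<open>A snake is built block by block, and the labelling grows with it from the inside out.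
  Suppose that a graph with \<open>m\<close> edges has a graceful labelling in which the vertex \<open>z\<close> carries an
  extreme label; place the labels in \<open>{-m..0}\<close> with \<open>z\<close> at \<open>0\<close>.  Let a second, bipartite graph
  share only \<open>z\<close> with the first, and let \<open>h\<close> label it so that \<open>h z = 0\<close>, every edge joins a
  label \<open>\<ge> 0\<close> to a label \<open>< 0\<close>, and the edge labels are exactly \<open>D\<close>.  Lowering the negative
  values of \<open>h\<close> by \<open>m\<close> puts all new labels outside \<open>{-m..0}\<close> and raises every new edge label by
  \<open>m\<close>, so that the union has the edge labels \<open>{1..m}\<close> and \<open>m + D\<close>.  This is
  \<open>outer_extension\<close>.

  For two ten-cycles sharing a vertex, \<open>pair_labellings\<close> gives such an \<open>h\<close> with \<open>D = {1..20}\<close>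
  and values in \<open>{-10..10}\<close> in which the vertex where the next pair will be attached has value
  \<open>10\<close> or \<open>-10\<close>.  It therefore receives an extreme label of the union, and the step can be
  repeated.  One such table is needed for each pair of distances (from the entry to the shared
  vertex, and from there to the exit), and the four alternatives of the theorem are precisely
  the patterns \<open>(s, s - 1)\<close> or \<open>(s, s)\<close>, pair after pair, for one \<open>s\<close> with \<open>2 \<le> s \<le> 5\<close>: the blocks
  numbered \<open>2\<close>, \<open>4\<close>, ... have the free distance \<open>s - 1\<close> or \<open>s\<close>, the blocks numbered \<open>3\<close>, \<open>5\<close>, ...
  the fixed distance \<open>s\<close>, and the missing distances in the two end blocks can be chosen.  An even
  snake consists of pairs alone, hence is graceful.  An odd snake ends in one more cycle, which
  is labelled with \<open>D = {1..9} \<union> {11}\<close>; this yields the near graceful labelling.  These steps are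
  \<open>attach_pair\<close>, \<open>attach_single\<close> and \<open>chain_of_cycles_labelling\<close>.

  The graph theory consists in turning the block-cutpoint path into such a chain of cycles.
  Two facts about blocks suffice: a vertex shared by two blocks is a cut vertex, and a cut vertex
  lies in two blocks.  The latter forces the block-cutpoint path to begin and end with a block, so
  that it alternates \<open>B 0, c 0, B 1, c 1, ...\<close>; the former shows that \<open>c i\<close> is the only vertex
  common to \<open>B i\<close> and \<open>B (Suc i)\<close> and that blocks further apart are disjoint.  Finally, the distance
  between two consecutive cut vertices in the whole graph equals their distance along the cycle
  containing both, since a potential that changes by at most one along every edge separates
  them.\<close>

section \<open>Walks and cycles as lists\<close>

definition steps :: "'a list \<Rightarrow> ('a \<times> 'a) list" where
  "steps ws = zip ws (tl ws)"

definition walk_edges :: "'a list \<Rightarrow> 'a set set" where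
  "walk_edges ws = (\<lambda>(u, v). {u, v}) ` set (steps ws)"

text \<open>A cycle is listed without repeating its first vertex; the closed walk returns to it.\<close>

definition closed_walk :: "'a list \<Rightarrow> 'a list" where
  "closed_walk xs = xs @ [hd xs]"

abbreviation cycle_edges :: "'a list \<Rightarrow> 'a set set" where
  "cycle_edges xs \<equiv> walk_edges (closed_walk xs)"

lemma steps_map: "steps (map h ws) = map (map_prod h h) (steps ws)"
  by (simp add: steps_def map_tl[symmetric] zip_map_map map_prod_def)

lemma closed_walk_map: "xs \<noteq> [] \<Longrightarrow> closed_walk (map h xs) = map h (closed_walk xs)"
  by (simp add: closed_walk_def hd_map)

lemma set_steps_subset: "set (steps ws) \<subseteq> set ws \<times> set ws"
proof
  fix x assume "x \<in> set (steps ws)"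
  then obtain a b where x: "x = (a, b)" and ab: "(a, b) \<in> set (zip ws (tl ws))"
    unfolding steps_def by (metis surj_pair)
  then show "x \<in> set ws \<times> set ws"
    using set_zip_leftD[OF ab] set_zip_rightD[OF ab] by (cases ws) auto
qed

lemma set_closed_walk: "xs \<noteq> [] \<Longrightarrow> set (closed_walk xs) = set xs"
  by (auto simp: closed_walk_def)

lemma walk_edgesE:
  assumes "e \<in> walk_edges ws"
  obtains u v where "e = {u, v}" "(u, v) \<in> set (steps ws)" "u \<in> set ws" "v \<in> set ws"
  using assms set_steps_subset[of ws] unfolding walk_edges_def by auto

lemma card_walk_edges_le: "card (walk_edges ws) \<le> length ws - 1"
  unfolding walk_edges_def
  by (rule order.trans[OF card_image_le]) (auto intro: order.trans[OF card_length] simp: steps_def)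

lemma finite_walk_edges: "finite (walk_edges ws)"
  by (simp add: walk_edges_def)

lemma walk_edges_Nil [simp]: "walk_edges [] = {}"
  and walk_edges_singleton [simp]: "walk_edges [x] = {}"
  and walk_edges_Cons [simp]: "walk_edges (x # y # zs) = insert {x, y} (walk_edges (y # zs))"
  by (simp_all add: walk_edges_def steps_def)

lemma walk_edges_snoc: "walk_edges (xs @ [x, y]) = insert {x, y} (walk_edges (xs @ [x]))"
proof (induction xs)
  case (Cons a xs)
  then show ?case
    by (cases xs) auto
qed simp

lemma walk_edges_rev: "walk_edges (rev xs) = walk_edges xs"
proof (induction xs rule: induct_list012)
  case (3 x y zs)
  then show ?case
    by (simp add: walk_edges_snoc insert_commute)
qed simp_all

lemma walk_edges_nth: "walk_edges xs = {{xs ! i, xs ! Suc i} | i. Suc i < length xs}"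
proof -
  have "set (steps xs) = (\<lambda>i. (xs ! i, xs ! Suc i)) ` {i. Suc i < length xs}"
    by (auto simp: steps_def set_zip nth_tl)
  then show ?thesis
    by (auto simp: walk_edges_def image_image)
qed

lemma cycle_edges_rotate1: "cycle_edges (rotate1 xs) = cycle_edges xs"
proof (cases xs rule: remdups_adj.cases)
  case (3 x y zs)
  then show ?thesis
    using walk_edges_snoc[of "y # zs" x y] by (simp add: closed_walk_def)
qed (simp_all add: closed_walk_def)

lemma cycle_edges_rotate: "cycle_edges (rotate n xs) = cycle_edges xs"
  by (induction n) (simp_all add: cycle_edges_rotate1)

lemma cycle_edges_reverse: "cycle_edges (x # rev xs) = cycle_edges (x # xs)"
  using walk_edges_rev[of "closed_walk (x # xs)"] by (simp add: closed_walk_def)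

definition cycle_listing :: "'a ugraph \<Rightarrow> 'a list \<Rightarrow> bool" where
  "cycle_listing H us \<longleftrightarrow>
     distinct us \<and> length us = 10 \<and> verts H = set us \<and> edges H = cycle_edges us"

lemma is_cycle_listing:
  assumes "is_cycle 10 H"
  obtains us where "cycle_listing H us"
proof -
  obtain vs where vs: "distinct vs" "length vs = 10" "verts H = set vs"
    and E: "edges H = {{vs ! i, vs ! (Suc i mod 10)} | i. i < 10}"
    using assms by (auto simp: is_cycle_def)
  have "vs \<noteq> []"
    using vs(2) by auto
  then have "closed_walk vs ! i = vs ! (i mod 10)" if "i \<le> 10" for i
    using that vs(2) by (cases "i = 10") (auto simp: closed_walk_def nth_append hd_conv_nth)
  then have "{closed_walk vs ! i, closed_walk vs ! Suc i} = {vs ! i, vs ! (Suc i mod 10)}" if "i < 10" for i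
    using that by simp
  moreover have "Suc i < length (closed_walk vs) \<longleftrightarrow> i < 10" for i
    using vs(2) by (auto simp: closed_walk_def)
  ultimately have "cycle_edges vs = edges H"
    unfolding walk_edges_nth E by (metis (no_types, lifting))
  then show thesis
    using that vs by (auto simp: cycle_listing_def)
qed

text \<open>Rotating the listing makes \<open>a\<close> the first vertex; if \<open>b\<close> then lies in the second half,
  traversing the cycle in the opposite direction brings it into the first half.\<close>

lemma cycle_listing_from_to:
  assumes us: "cycle_listing H us" and ab: "a \<in> verts H" "b \<in> verts H"
  obtains vs p where "cycle_listing H vs" "vs ! 0 = a" "p \<le> 5" "vs ! p = b"
proof -
  obtain i where i: "i < 10" "us ! i = a"
    using us ab by (auto simp: cycle_listing_def in_set_conv_nth)
  define vs where "vs = rotate i us"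
  have vs: "cycle_listing H vs" "vs ! 0 = a"
    using us i by (simp_all add: cycle_listing_def vs_def cycle_edges_rotate nth_rotate)
  obtain q where q: "q < 10" "vs ! q = b"
    using vs ab by (auto simp: cycle_listing_def in_set_conv_nth)
  show thesis
  proof (cases "q \<le> 5")
    case True
    then show thesis
      using that vs q by blast
  next
    case False
    obtain ws where ws: "vs = a # ws" "length ws = 9"
      using vs by (cases vs) (auto simp: cycle_listing_def)
    have "cycle_listing H (a # rev ws)"
      using vs(1) by (simp add: cycle_listing_def ws cycle_edges_reverse)
    moreover have "(a # rev ws) ! (10 - q) = b"
      using q False ws by (simp add: rev_nth nth_Cons')
    ultimately show thesis
      using that[of "a # rev ws" "10 - q"] False by simp
  qed
qed

section \<open>Blocks and cut vertices\<close>

lemma in_adj [simp]: "(u, v) \<in> adj G \<longleftrightarrow> {u, v} \<in> edges G"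
  by (simp add: adj_def)

lemma in_edges_delete_vertex [simp]:
  "e \<in> edges (delete_vertex G x) \<longleftrightarrow> e \<in> edges G \<and> x \<notin> e"
  by (simp add: delete_vertex_def)

lemma adj_rtrancl_sym: "(u, v) \<in> (adj G)\<^sup>* \<Longrightarrow> (v, u) \<in> (adj G)\<^sup>*"
  by (rule symD[OF sym_rtrancl]) (auto simp: sym_def insert_commute)

abbreviation linked_avoiding :: "'a ugraph \<Rightarrow> 'a \<Rightarrow> 'a \<Rightarrow> 'a \<Rightarrow> bool" where
  "linked_avoiding G x u w \<equiv> (u, w) \<in> (adj (delete_vertex G x))\<^sup>*"

lemma adj_rtrancl_mono: "edges H \<subseteq> edges G \<Longrightarrow> (u, v) \<in> (adj H)\<^sup>* \<Longrightarrow> (u, v) \<in> (adj G)\<^sup>*"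
  by (rule subsetD[OF rtrancl_mono]) auto

lemma linked_avoiding_mono:
  "edges H \<subseteq> edges G \<Longrightarrow> linked_avoiding H x u v \<Longrightarrow> linked_avoiding G x u v"
  by (rule subsetD[OF rtrancl_mono]) auto

lemma linked_avoiding_imp_connected: "linked_avoiding G x u v \<Longrightarrow> (u, v) \<in> (adj G)\<^sup>*"
  by (rule subsetD[OF rtrancl_mono]) auto

lemma simple_graph_edge:
  assumes "simple_graph G" "{u, v} \<in> edges G"
  shows "u \<in> verts G" "v \<in> verts G" "u \<noteq> v"
  using assms by (auto simp: simple_graph_def doubleton_eq_iff dest!: subsetD)

lemma nonseparable_linked:
  assumes "simple_graph H" "nonseparable H" "u \<in> verts H" "w \<in> verts H" "u \<noteq> x" "w \<noteq> x"
  shows "linked_avoiding H x u w"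
proof -
  have uw: "(u, w) \<in> (adj H)\<^sup>*"
    using assms by (auto simp: nonseparable_def connected_graph_def)
  show ?thesis
  proof (cases "x \<in> verts H")
    case True
    then show ?thesis
      using assms uw by (auto simp: nonseparable_def cut_vertex_def)
  next
    case False
    then have "adj H \<subseteq> adj (delete_vertex H x)"
      using simple_graph_edge[OF assms(1)] by auto
    then show ?thesis
      using uw rtrancl_mono by blast
  qed
qed

lemma subgraph_trans: "subgraph H K \<Longrightarrow> subgraph K G \<Longrightarrow> subgraph H G"
  by (auto simp: subgraph_def)

lemma finite_simple_graph:
  assumes "simple_graph G"
  shows "finite (verts G)" "finite (edges G)"
proof -
  show "finite (verts G)"
    using assms by (simp add: simple_graph_def)
  moreover have "edges G \<subseteq> Pow (verts G)"
    using assms by (auto simp: simple_graph_def)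
  ultimately show "finite (edges G)"
    by (meson finite_Pow_iff finite_subset)
qed

text \<open>Blocks are maximal, so the block is found by maximising the number of vertices plus edges.\<close>

lemma nonseparable_in_block:
  assumes G: "simple_graph G" and H: "subgraph H G" "nonseparable H"
  obtains B where "B \<in> blocks G" "subgraph H B"
proof -
  let ?P = "\<lambda>K. subgraph K G \<and> nonseparable K \<and> subgraph H K"
  let ?size = "\<lambda>K. card (verts K) + card (edges K)"
  have "?P H"
    using H by (auto simp: subgraph_def)
  moreover have "\<forall>K. ?P K \<longrightarrow> ?size K < Suc (?size G)"
    using finite_simple_graph[OF G]
    by (auto simp: subgraph_def less_Suc_eq_le intro!: add_mono card_mono)
  ultimately have "\<exists>B. ?P B \<and> (\<forall>K. ?P K \<longrightarrow> ?size K \<le> ?size B)"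
    by (rule Lattices_Big.ex_has_greatest_nat)
  then obtain B where B: "?P B" and max: "\<And>K. ?P K \<Longrightarrow> ?size K \<le> ?size B"
    by (elim exE conjE) simp
  have "K = B" if K: "subgraph K G" "nonseparable K" "subgraph B K" for K
  proof -
    have fin: "finite (verts K)" "finite (edges K)"
      using K(1) finite_simple_graph[of K] by (auto simp: subgraph_def)
    have sub: "verts B \<subseteq> verts K" "edges B \<subseteq> edges K"
      using K(3) by (auto simp: subgraph_def)
    have "?size K \<le> ?size B"
      using K B subgraph_trans by (intro max) blast
    then have "card (verts B) = card (verts K)" "card (edges B) = card (edges K)"
      using card_mono[OF fin(1) sub(1)] card_mono[OF fin(2) sub(2)] by linarith+
    then have "verts B = verts K" "edges B = edges K"
      using card_subset_eq fin sub by metis+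
    then show ?thesis
      by (simp add: prod_eq_iff)
  qed
  then have "B \<in> blocks G"
    using B by (auto simp: blocks_def)
  then show thesis
    using B that by blast
qed

lemma edge_in_block:
  assumes "simple_graph G" "{a, b} \<in> edges G"
  obtains B where "B \<in> blocks G" "{a, b} \<in> edges B" "a \<in> verts B" "b \<in> verts B"
proof -
  let ?K = "({a, b}, {{a, b}})"
  have ab: "a \<in> verts G" "b \<in> verts G" "a \<noteq> b"
    using simple_graph_edge assms by fast+
  have "subgraph ?K G"
    using ab assms by (auto simp: subgraph_def simple_graph_def)
  moreover have "connected_graph ?K"
    by (auto simp: connected_graph_def insert_commute)
  then have "nonseparable ?K"
    by (auto simp: nonseparable_def cut_vertex_def)
  ultimately obtain B where "B \<in> blocks G" "subgraph ?K B"
    using nonseparable_in_block assms(1) by blast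
  then show thesis
    using that by (auto simp: subgraph_def)
qed

lemma vertex_in_block:
  assumes "simple_graph G" "a \<in> verts G"
  obtains B where "B \<in> blocks G" "a \<in> verts B"
proof -
  have "subgraph ({a}, {}) G"
    using assms by (auto simp: subgraph_def simple_graph_def)
  moreover have "nonseparable ({a}, {})"
    by (auto simp: nonseparable_def connected_graph_def cut_vertex_def)
  ultimately obtain B where "B \<in> blocks G" "subgraph ({a}, {}) B"
    using nonseparable_in_block assms(1) by blast
  then show thesis
    using that by (auto simp: subgraph_def)
qed

lemma union_of_blocks:
  assumes "simple_graph G"
  shows "verts G = (\<Union>B\<in>blocks G. verts B)" "edges G = (\<Union>B\<in>blocks G. edges B)"
proof -
  have "a \<in> (\<Union>B\<in>blocks G. verts B)" if "a \<in> verts G" for a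
    using vertex_in_block[OF assms that] by blast
  then show "verts G = (\<Union>B\<in>blocks G. verts B)"
    by (auto simp: blocks_def subgraph_def)
  have "e \<in> (\<Union>B\<in>blocks G. edges B)" if e: "e \<in> edges G" for e
  proof -
    obtain a b where "e = {a, b}"
      using e assms by (auto simp: simple_graph_def)
    with e have "{a, b} \<in> edges G"
      by simp
    then obtain B where "B \<in> blocks G" "{a, b} \<in> edges B"
      using edge_in_block[OF assms] by metis
    then show ?thesis
      using \<open>e = {a, b}\<close> by auto
  qed
  then show "edges G = (\<Union>B\<in>blocks G. edges B)"
    by (auto simp: blocks_def subgraph_def)
qed

text \<open>A walk of least length cannot visit a vertex twice, because the detour could be cut out.\<close>

lemma shortest_walk:
  assumes "(u, w) \<in> R\<^sup>*"
  obtains g :: "nat \<Rightarrow> 'a" and n where "g 0 = u" "g n = w" "\<And>i. i < n \<Longrightarrow> (g i, g (Suc i)) \<in> R"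
    "inj_on g {..n}"
proof -
  define n where "n = (LEAST n. (u, w) \<in> R ^^ n)"
  have "(u, w) \<in> R ^^ n"
    using assms unfolding rtrancl_power n_def by (rule LeastI_ex)
  then obtain g where g: "g 0 = u" "g n = w" "\<And>i. i < n \<Longrightarrow> (g i, g (Suc i)) \<in> R"
    by (auto simp: relpow_fun_conv)
  have "g i \<noteq> g j" if ij: "i < j" "j \<le> n" for i j
  proof
    assume eq: "g i = g j"
    have "(u, g i) \<in> R ^^ i"
      unfolding relpow_fun_conv using g ij by (intro exI[of _ g]) auto
    moreover have "(g j, w) \<in> R ^^ (n - j)"
      unfolding relpow_fun_conv using g ij by (intro exI[of _ "\<lambda>t. g (j + t)"]) auto
    ultimately have "(u, w) \<in> R ^^ (i + (n - j))"
      using eq by (auto simp: relpow_add)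
    moreover have "i + (n - j) < n"
      using ij by linarith
    ultimately show False
      unfolding n_def using not_less_Least by blast
  qed
  then have "inj_on g {..n}"
    by (intro linorder_inj_onI') auto
  with g show thesis
    using that by blast
qed

text \<open>Otherwise the two blocks are joined by a path that avoids \<open>v\<close>.  The union \<open>H\<close> of both
  blocks and this path is nonseparable: after removing a vertex \<open>x\<close>, what is left of each block is
  connected, every remaining piece of the path hangs on one of the two blocks, and the blocks are
  linked by \<open>v\<close>, or by the path if \<open>x = v\<close>.  This contradicts the maximality of both blocks.\<close>

lemma shared_vertex_is_cut_vertex:
  assumes G: "simple_graph G" "connected_graph G"
    and B: "B \<in> blocks G" "B' \<in> blocks G" "B \<noteq> B'"
    and v: "v \<in> verts B" "v \<in> verts B'"
    and uw: "u \<in> verts B" "u \<noteq> v" "w \<in> verts B'" "w \<noteq> v"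
  shows "cut_vertex G v"
proof (rule ccontr)
  assume not_cut: "\<not> cut_vertex G v"
  have simpleB: "simple_graph B" "simple_graph B'" and nonsep: "nonseparable B" "nonseparable B'"
    and sub: "verts B \<subseteq> verts G" "edges B \<subseteq> edges G" "verts B' \<subseteq> verts G" "edges B' \<subseteq> edges G"
    using B by (auto simp: blocks_def subgraph_def)
  have "u \<in> verts G" "w \<in> verts G"
    using uw sub by blast+
  then have "(u, w) \<in> (adj G)\<^sup>*"
    using G(2) unfolding connected_graph_def by blast
  then have "linked_avoiding G v u w"
    using not_cut uw v sub \<open>u \<in> verts G\<close> \<open>w \<in> verts G\<close> unfolding cut_vertex_def by blast
  then obtain g :: "nat \<Rightarrow> 'a" and n where g: "g 0 = u" "g n = w"
    and step: "\<And>i. i < n \<Longrightarrow> (g i, g (Suc i)) \<in> adj (delete_vertex G v)"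
    and inj: "inj_on g {..n}"
    by (rule shortest_walk) blast
  have gE: "{g i, g (Suc i)} \<in> edges G" "g i \<noteq> v" "g (Suc i) \<noteq> v" if "i < n" for i
    using step[OF that] by auto
  have gv: "g i \<in> verts G" "g i \<noteq> v" if "i \<le> n" for i
  proof -
    show "g i \<noteq> v"
      using that gE[of i] g uw by (cases "i = n") auto
    show "g i \<in> verts G"
      using that gE(1)[of i] simple_graph_edge[OF G(1)] g uw sub by (cases "i = n") auto
  qed
  define H where "H = (verts B \<union> verts B' \<union> g ` {..n},
      edges B \<union> edges B' \<union> (\<lambda>i. {g i, g (Suc i)}) ` {..<n})"
  have HV: "verts H = verts B \<union> verts B' \<union> g ` {..n}"
    and HE: "edges H = edges B \<union> edges B' \<union> (\<lambda>i. {g i, g (Suc i)}) ` {..<n}"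
    by (simp_all add: H_def)
  have "e \<in> {{a, b} | a b. a \<in> verts H \<and> b \<in> verts H \<and> a \<noteq> b}" if e: "e \<in> edges H" for e
  proof -
    consider "e \<in> edges B" | "e \<in> edges B'" | i where "i < n" "e = {g i, g (Suc i)}"
      using e HE by auto
    then show ?thesis
    proof cases
      case 3
      then have "g i \<noteq> g (Suc i)"
        using gE(1) simple_graph_edge(3)[OF G(1)] by blast
      then show ?thesis
        using 3 unfolding HV by (intro CollectI exI[of _ "g i"] exI[of _ "g (Suc i)"]) auto
    qed (use simpleB in \<open>auto simp: simple_graph_def HV\<close>, blast+)
  qed
  then have "simple_graph H"
    using finite_simple_graph(1)[OF simpleB(1)] finite_simple_graph(1)[OF simpleB(2)]
    by (auto simp: simple_graph_def HV)
  then have "subgraph H G"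
    using sub gv gE by (auto simp: subgraph_def HV HE)
  have BH: "edges B \<subseteq> edges H" "edges B' \<subseteq> edges H"
    by (auto simp: HE)
  have along: "linked_avoiding H x (g i) (g j)"
    if "i \<le> j" "j \<le> n" "\<And>t. i \<le> t \<Longrightarrow> t \<le> j \<Longrightarrow> g t \<noteq> x" for x i j
    using that
  proof (induction j rule: dec_induct)
    case (step j)
    then have "linked_avoiding H x (g i) (g j)"
      by simp
    moreover have "(g j, g (Suc j)) \<in> adj (delete_vertex H x)"
      using step.hyps step.prems(1) step.prems(2)[of j] step.prems(2)[of "Suc j"]
      by (auto simp: HE)
    ultimately show ?case
      by (rule rtrancl_into_rtrancl)
  qed simp
  \<comment> \<open>Whatever vertex is removed, everything else is still linked to one fixed vertex.\<close>
  have hub: "linked_avoiding H x y (if x = v then u else v)" if y: "y \<in> verts H" "y \<noteq> x" for x y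
  proof -
    let ?hub = "if x = v then u else v"
    have inB: "linked_avoiding H x y ?hub" if "y \<in> verts B" "y \<noteq> x" for y
      using that nonseparable_linked[OF simpleB(1) nonsep(1)] uw v
      by (intro linked_avoiding_mono[OF BH(1)]) auto
    have inB': "linked_avoiding H x y ?hub" if y: "y \<in> verts B'" "y \<noteq> x" for y
    proof (cases "x = v")
      case True
      then have "linked_avoiding H x y w"
        using y nonseparable_linked[OF simpleB(2) nonsep(2)] uw
        by (intro linked_avoiding_mono[OF BH(2)]) auto
      moreover have "linked_avoiding H x w u"
        using along[of 0 n x] True gv(2) g by (auto intro: adj_rtrancl_sym)
      ultimately show ?thesis
        using True by auto
    next
      case False
      then show ?thesis
        using y nonseparable_linked[OF simpleB(2) nonsep(2)] v
        by (intro linked_avoiding_mono[OF BH(2)]) auto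
    qed
    show ?thesis
    proof (cases "y \<in> verts B \<union> verts B'")
      case True
      then show ?thesis
        using inB inB' y(2) by blast
    next
      case False
      then obtain i where i: "i \<le> n" "y = g i"
        using y(1) HV by auto
      \<comment> \<open>The path meets \<open>x\<close> at most once, hence one of the two directions is free.\<close>
      show ?thesis
      proof (cases "\<exists>j<i. g j = x")
        case True
        then obtain j where j: "j < i" "g j = x"
          by blast
        then have "g t \<noteq> x" if "i \<le> t" "t \<le> n" for t
          using inj_onD[OF inj, of t j] that i by auto
        then have "linked_avoiding H x y w" "w \<noteq> x"
          using along[of i n x] i g by auto
        then show ?thesis
          using inB'[of w] uw by (meson rtrancl_trans)
      next
        case False
        then have "g t \<noteq> x" if "t \<le> i" for t
          using that i y by (metis le_neq_implies_less)
        then have "linked_avoiding H x u y" "u \<noteq> x"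
          using along[of 0 i x] i g by auto
        then show ?thesis
          using inB[of u] uw by (meson rtrancl_trans adj_rtrancl_sym)
      qed
    qed
  qed
  have linked: "linked_avoiding H x y y'" if "y \<in> verts H - {x}" "y' \<in> verts H - {x}" for x y y'
    using rtrancl_trans[OF hub[of y x] adj_rtrancl_sym[OF hub[of y' x]]] that by simp
  have "(y, u) \<in> (adj H)\<^sup>*" if "y \<in> verts H" for y
  proof (cases "y = v")
    case True
    have "(v, u) \<in> (adj B)\<^sup>*"
      using nonsep(1) v uw by (auto simp: nonseparable_def connected_graph_def)
    then show ?thesis
      using adj_rtrancl_mono[OF BH(1)] True by blast
  next
    case False
    then show ?thesis
      using hub[of y v] that by (auto intro: linked_avoiding_imp_connected)
  qed
  then have "(y, y') \<in> (adj H)\<^sup>*" if "y \<in> verts H" "y' \<in> verts H" for y y'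
    using rtrancl_trans[OF _ adj_rtrancl_sym, of y u H y'] that by simp
  then have "connected_graph H"
    using v HV by (auto simp: connected_graph_def)
  then have "nonseparable H"
    using linked by (auto simp: nonseparable_def cut_vertex_def)
  moreover have "subgraph B H" "subgraph B' H"
    using simpleB by (auto simp: subgraph_def HV HE)
  ultimately have "H = B" "H = B'"
    using B(1,2) \<open>subgraph H G\<close> unfolding blocks_def mem_Collect_eq by blast+
  then show False
    using B(3) by simp
qed

text \<open>If \<open>c\<close> separates \<open>u\<close> from \<open>w\<close>, walks from these towards \<open>c\<close> arrive through neighbours
  \<open>a\<close> and \<open>b\<close> of \<open>c\<close> that are themselves separated by \<open>c\<close>.  A block containing both edges would
  link \<open>a\<close> to \<open>b\<close> without \<open>c\<close>, so the two edges lie in different blocks.\<close>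

lemma cut_vertex_in_two_blocks:
  assumes G: "simple_graph G" "connected_graph G" and c: "cut_vertex G c"
  obtains B B' where "B \<in> blocks G" "B' \<in> blocks G" "B \<noteq> B'" "c \<in> verts B" "c \<in> verts B'"
proof -
  obtain u w where uw: "u \<in> verts G" "u \<noteq> c" "w \<in> verts G" "w \<noteq> c"
    and sep: "\<not> linked_avoiding G c u w" and "c \<in> verts G"
    using c by (auto simp: cut_vertex_def)
  have nbr: "\<exists>a. linked_avoiding G c y a \<and> {a, c} \<in> edges G" if "y \<in> verts G" "y \<noteq> c" for y
  proof -
    have "(y, c) \<in> (adj G)\<^sup>*"
      using G(2) that \<open>c \<in> verts G\<close> by (auto simp: connected_graph_def)
    then show ?thesis
      using that(2)
    proof (induction rule: converse_rtrancl_induct)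
      case (step y y')
      show ?case
      proof (cases "y' = c")
        case True
        then show ?thesis
          using step by auto
      next
        case False
        then obtain a where "linked_avoiding G c y' a" "{a, c} \<in> edges G"
          using step by blast
        moreover have "(y, y') \<in> adj (delete_vertex G c)"
          using step False by auto
        ultimately show ?thesis
          by (meson converse_rtrancl_into_rtrancl)
      qed
    qed simp
  qed
  obtain a where a: "linked_avoiding G c u a" "{a, c} \<in> edges G"
    using nbr uw by blast
  obtain b where b: "linked_avoiding G c w b" "{b, c} \<in> edges G"
    using nbr uw by blast
  obtain B where B: "B \<in> blocks G" "{a, c} \<in> edges B" "a \<in> verts B" "c \<in> verts B"
    using edge_in_block[OF G(1) a(2)] .
  obtain B' where B': "B' \<in> blocks G" "{b, c} \<in> edges B'" "b \<in> verts B'" "c \<in> verts B'"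
    using edge_in_block[OF G(1) b(2)] .
  have "B \<noteq> B'"
  proof
    assume "B = B'"
    moreover have "a \<noteq> c" "b \<noteq> c"
      using simple_graph_edge(3)[OF G(1)] a b by blast+
    moreover have "simple_graph B" "nonseparable B" "edges B \<subseteq> edges G"
      using B(1) by (auto simp: blocks_def subgraph_def)
    ultimately have "linked_avoiding B c a b" "edges B \<subseteq> edges G"
      using nonseparable_linked[of B a b c] B(3) B'(3) by simp_all
    then have "linked_avoiding G c a b"
      by (rule linked_avoiding_mono[rotated])
    then show False
      using sep a b by (meson adj_rtrancl_sym rtrancl_trans)
  qed
  then show thesis
    using that B B' by blast
qed

section \<open>The blocks along a snake\<close>

lemma path_listing_neighbour:
  assumes "path_listing H xs" "i < length xs" "{xs ! i, y} \<in> edges H"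
  obtains j where "j < length xs" "y = xs ! j" "j = Suc i \<or> i = Suc j"
proof -
  have "distinct xs"
    using assms(1) by (simp add: path_listing_def)
  obtain a where a: "Suc a < length xs" "{xs ! i, y} = {xs ! a, xs ! Suc a}"
    using assms(1,3) by (auto simp: path_listing_def)
  then consider "xs ! i = xs ! a" "y = xs ! Suc a" | "xs ! i = xs ! Suc a" "y = xs ! a"
    by (auto simp: doubleton_eq_iff)
  then show thesis
  proof cases
    case 1
    then have "i = a"
      using \<open>distinct xs\<close> a(1) assms(2) by (simp add: nth_eq_iff_index_eq)
    then show thesis
      using that[of "Suc a"] a 1 by simp
  next
    case 2
    then have "i = Suc a"
      using \<open>distinct xs\<close> a(1) assms(2) by (simp add: nth_eq_iff_index_eq)
    then show thesis
      using that[of a] a 2 by simp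
  qed
qed

lemma block_cutpoint_graph_simps:
  "verts (block_cutpoint_graph G) = Inl ` blocks G \<union> Inr ` {c. cut_vertex G c}"
  "{Inl B, Inr c} \<in> edges (block_cutpoint_graph G) \<longleftrightarrow>
     B \<in> blocks G \<and> cut_vertex G c \<and> c \<in> verts B"
  by (auto simp: block_cutpoint_graph_def doubleton_eq_iff simp del: split_paired_Ex)

text \<open>A cut vertex has at least two neighbours in the block-cutpoint graph, an end of the path only one.\<close>

lemma path_listing_end_isl:
  assumes G: "simple_graph G" "connected_graph G"
    and xs: "path_listing (block_cutpoint_graph G) xs"
    and i: "i = 0 \<or> i = length xs - 1"
  shows "isl (xs ! i)"
proof (rule ccontr)
  assume "\<not> isl (xs ! i)"
  then obtain c where c: "xs ! i = Inr c"
    by (cases "xs ! i") auto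
  have len: "i < length xs"
    using xs i by (auto simp: path_listing_def)
  then have "Inr c \<in> verts (block_cutpoint_graph G)"
    using xs c by (metis nth_mem path_listing_def)
  then have "cut_vertex G c"
    by (auto simp: block_cutpoint_graph_simps)
  then obtain B B' where B: "B \<in> blocks G" "B' \<in> blocks G" "B \<noteq> B'" "c \<in> verts B" "c \<in> verts B'"
    using cut_vertex_in_two_blocks[OF G] by metis
  have nbr: "Inl K = xs ! (if i = 0 then 1 else i - 1)" if K: "K \<in> blocks G" "c \<in> verts K" for K
  proof -
    have "{Inl K, Inr c} \<in> edges (block_cutpoint_graph G)"
      using K \<open>cut_vertex G c\<close> by (simp add: block_cutpoint_graph_simps)
    then have "{xs ! i, Inl K} \<in> edges (block_cutpoint_graph G)"
      by (simp add: c insert_commute)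
    then obtain j where j: "j < length xs" "Inl K = xs ! j" "j = Suc i \<or> i = Suc j"
      by (rule path_listing_neighbour[OF xs len])
    have "j = (if i = 0 then 1 else i - 1)"
      using i j(1,3) by auto
    with j(2) show ?thesis
      by simp
  qed
  then have "Inl B = (Inl B' :: 'a ugraph + 'a)"
    using B by metis
  then show False
    using B(3) by simp
qed

text \<open>The vertex \<open>c i\<close> is the unique common vertex of the blocks \<open>B i\<close> and \<open>B (Suc i)\<close>; any other
  two blocks are disjoint.\<close>

definition snake_blocks ::
  "nat \<Rightarrow> (nat \<Rightarrow> 'a ugraph) \<Rightarrow> (nat \<Rightarrow> 'a) \<Rightarrow> 'a ugraph \<Rightarrow> bool" where
  "snake_blocks k B c G \<longleftrightarrow> blocks G = B ` {..<k} \<and>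
     (\<forall>i. Suc i < k \<longrightarrow> c i \<in> verts (B i) \<and> c i \<in> verts (B (Suc i))) \<and>
     (\<forall>i j x. i < j \<and> j < k \<and> x \<in> verts (B i) \<and> x \<in> verts (B j) \<longrightarrow> j = Suc i \<and> x = c i)"

text \<open>Blocks and cut vertices alternate along the path, beginning and ending with a block.  A
  vertex shared by two blocks is a cut vertex adjacent to both in the block-cutpoint graph, so that
  these blocks stand immediately before and after it on the path.\<close>

lemma snake_blocks_of_path_listing:
  fixes G :: "'a ugraph"
  assumes snake: "cyclic_snake k r G" and xs: "path_listing (block_cutpoint_graph G) xs"
  obtains B c where "snake_blocks k B c G" "length xs = 2 * k - 1"
    "\<forall>i<k. xs ! (2 * i) = Inl (B i)" "\<forall>i. Suc i < k \<longrightarrow> xs ! Suc (2 * i) = Inr (c i)"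
proof -
  let ?T = "block_cutpoint_graph G"
  have G: "simple_graph G" "connected_graph G" and card: "card (blocks G) = k"
    and cyc: "\<And>B. B \<in> blocks G \<Longrightarrow> is_cycle r B"
    using snake by (auto simp: cyclic_snake_def)
  have dist: "distinct xs" and ne: "xs \<noteq> []" and VT: "verts ?T = set xs"
    and ET: "edges ?T = {{xs ! i, xs ! Suc i} | i. Suc i < length xs}"
    using xs by (auto simp: path_listing_def)
  have step: "isl (xs ! Suc i) \<longleftrightarrow> \<not> isl (xs ! i)" if "Suc i < length xs" for i
  proof -
    have "{xs ! i, xs ! Suc i} \<in> edges ?T"
      using that ET by auto
    then show ?thesis
      by (auto simp: block_cutpoint_graph_def doubleton_eq_iff)
  qed
  have isl: "isl (xs ! i) \<longleftrightarrow> even i" if "i < length xs" for i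
    using that
  proof (induction i)
    case 0
    then show ?case
      using path_listing_end_isl[OF G xs, of 0] by simp
  qed (simp add: step)
  have "isl (xs ! (length xs - 1))"
    by (rule path_listing_end_isl[OF G xs]) simp
  then have "even (length xs - 1)"
    using isl[of "length xs - 1"] ne by simp
  then obtain n where n: "length xs - 1 = 2 * n"
    by (elim evenE)
  then have len: "length xs = Suc (2 * n)"
    using ne by (cases xs) auto
  define B where "B i = projl (xs ! (2 * i))" for i
  define c where "c i = projr (xs ! Suc (2 * i))" for i
  have B: "xs ! (2 * i) = Inl (B i)" if "i \<le> n" for i
    using isl[of "2 * i"] that len by (simp add: B_def)
  have c: "xs ! Suc (2 * i) = Inr (c i)" if "i < n" for i
    using isl[of "Suc (2 * i)"] that len by (cases "xs ! Suc (2 * i)") (auto simp: c_def)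
  have inj: "i = j" if "B i = B j" "i \<le> n" "j \<le> n" for i j
  proof -
    have "xs ! (2 * i) = xs ! (2 * j)"
      using B that by simp
    then show ?thesis
      using dist len that by (simp add: nth_eq_iff_index_eq)
  qed
  have blocks: "blocks G = B ` {..n}"
  proof (intro equalityI subsetI)
    fix K assume "K \<in> blocks G"
    then have "Inl K \<in> set xs"
      unfolding VT[symmetric] block_cutpoint_graph_simps by simp
    then obtain i where i: "i < length xs" "xs ! i = Inl K"
      by (auto simp: in_set_conv_nth)
    then have "even i"
      using isl[OF i(1)] by simp
    then obtain j where "i = 2 * j"
      by auto
    then show "K \<in> B ` {..n}"
      using i len by (intro image_eqI[of _ _ j]) (auto simp: B_def)
  next
    fix K assume "K \<in> B ` {..n}"
    then obtain i where i: "i \<le> n" "K = B i"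
      by auto
    then have "Inl K = xs ! (2 * i)" "2 * i < length xs"
      using B len by auto
    then have "Inl K \<in> set xs"
      by (metis nth_mem)
    then show "K \<in> blocks G"
      unfolding VT[symmetric] block_cutpoint_graph_simps by blast
  qed
  have "inj_on B {..n}"
    using inj by (auto simp: inj_on_def)
  then have k: "k = Suc n"
    using card blocks by (simp add: card_image)
  have other: "\<exists>u \<in> verts (B i). u \<noteq> x" if "i \<le> n" for i x
  proof -
    have "is_cycle r (B i)"
      using that blocks cyc by auto
    then obtain vs where vs: "distinct vs" "3 \<le> length vs" "verts (B i) = set vs"
      by (auto simp: is_cycle_def)
    then have "0 < length vs" "1 < length vs"
      by linarith+
    with vs have "vs ! 0 \<noteq> vs ! 1" "vs ! 0 \<in> verts (B i)" "vs ! 1 \<in> verts (B i)"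
      using nth_eq_iff_index_eq[of vs 0 1] nth_mem[of 0 vs] nth_mem[of 1 vs] by simp_all
    then show ?thesis
      by metis
  qed
  have meet: "j = Suc i \<and> x = c i" if ij: "i < j" "j \<le> n" and x: "x \<in> verts (B i)" "x \<in> verts (B j)" for i j x
  proof -
    have Bij: "B i \<in> blocks G" "B j \<in> blocks G" "B i \<noteq> B j"
      using ij inj[of i j] blocks by auto
    obtain u w where "u \<in> verts (B i)" "u \<noteq> x" "w \<in> verts (B j)" "w \<noteq> x"
      using other[of i x] other[of j x] ij by auto
    then have cut: "cut_vertex G x"
      using shared_vertex_is_cut_vertex[OF G Bij x] by blast
    have edge: "{xs ! (2 * i), Inr x} \<in> edges ?T" "{xs ! (2 * j), Inr x} \<in> edges ?T"
      using cut Bij x ij by (simp_all add: B block_cutpoint_graph_simps)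
    have "2 * i < length xs" "2 * j < length xs"
      using ij len by auto
    obtain a where a: "a < length xs" "Inr x = xs ! a" "a = Suc (2 * i) \<or> 2 * i = Suc a"
      by (rule path_listing_neighbour[OF xs \<open>2 * i < length xs\<close> edge(1)])
    obtain b where b: "b < length xs" "Inr x = xs ! b" "b = Suc (2 * j) \<or> 2 * j = Suc b"
      by (rule path_listing_neighbour[OF xs \<open>2 * j < length xs\<close> edge(2)])
    have "a = b"
      using dist a b nth_eq_iff_index_eq[of xs a b] by simp
    then have "a = Suc (2 * i)" "j = Suc i"
      using a(3) b(3) ij(1) by presburger+
    then show ?thesis
      using c[of i] a(2) ij by simp
  qed
  have c_mem: "c i \<in> verts (B i)" "c i \<in> verts (B (Suc i))" if "i < n" for i
  proof -
    have "{xs ! (2 * i), xs ! Suc (2 * i)} \<in> edges ?T"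
      using ET len that by auto
    moreover have "{xs ! (2 * Suc i), xs ! Suc (2 * i)} \<in> edges ?T"
      using ET len that by (auto simp: insert_commute)
    ultimately show "c i \<in> verts (B i)" "c i \<in> verts (B (Suc i))"
      using that B[of i] B[of "Suc i"] c[of i] by (simp_all add: block_cutpoint_graph_simps)
  qed
  have "snake_blocks k B c G"
    unfolding snake_blocks_def
  proof (intro conjI allI impI)
    show "blocks G = B ` {..<k}"
      by (simp add: blocks k lessThan_Suc_atMost)
    show "c i \<in> verts (B i)" "c i \<in> verts (B (Suc i))" if "Suc i < k" for i
      using c_mem[of i] that k by simp_all
    fix i j x assume "i < j \<and> j < k \<and> x \<in> verts (B i) \<and> x \<in> verts (B j)"
    then show "j = Suc i" "x = c i"
      using meet[of i j x] k by simp_all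
  qed
  moreover have "\<forall>i<k. xs ! (2 * i) = Inl (B i)" "\<forall>i. Suc i < k \<longrightarrow> xs ! Suc (2 * i) = Inr (c i)"
    using B c k by simp_all
  moreover have "length xs = 2 * k - 1"
    using len k by simp
  ultimately show thesis
    using that by blast
qed

lemma cut_vertices_of_alternating_list:
  assumes "length xs = Suc (2 * n)" "\<And>i. i \<le> n \<Longrightarrow> xs ! (2 * i) = Inl (B i)"
    "\<And>i. i < n \<Longrightarrow> xs ! Suc (2 * i) = Inr (c i)"
  shows "[c. Inr c \<leftarrow> xs] = map c [0..<n]"
  using assms
proof (induction n arbitrary: xs)
  case 0
  then obtain x where "xs = [x]"
    by (auto simp: length_Suc_conv)
  then show ?case
    using 0(2)[of 0] by simp
next
  case (Suc n)
  define ys where "ys = take (Suc (2 * n)) xs"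
  have "xs = ys @ [xs ! Suc (2 * n), xs ! (2 * Suc n)]"
    unfolding ys_def using Suc.prems(1)
    by (intro nth_equalityI) (auto simp: nth_append nth_Cons' less_Suc_eq)
  also have "\<dots> = ys @ [Inr (c n), Inl (B (Suc n))]"
    using Suc.prems(2)[of "Suc n"] Suc.prems(3)[of n] by simp
  finally have xs: "xs = ys @ [Inr (c n), Inl (B (Suc n))]" .
  have "[c. Inr c \<leftarrow> ys] = map c [0..<n]"
    using Suc.prems by (intro Suc.IH) (auto simp: ys_def)
  then show ?case
    by (subst xs) simp
qed

lemma snake_string_blocks:
  assumes "cyclic_snake k r G" "snake_string G d" "1 \<le> k"
  obtains B c where "snake_blocks k B c G"
    "\<forall>i<k - 2. d ! i = graph_dist G (c i) (c (Suc i))"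
proof -
  obtain xs where xs: "path_listing (block_cutpoint_graph G) xs"
    and d: "d = map2 (graph_dist G) [c. Inr c \<leftarrow> xs] (tl [c. Inr c \<leftarrow> xs])"
    using assms(2) by (auto simp: snake_string_def Let_def)
  obtain B c where B: "snake_blocks k B c G" "length xs = 2 * k - 1"
    "\<forall>i<k. xs ! (2 * i) = Inl (B i)" "\<forall>i. Suc i < k \<longrightarrow> xs ! Suc (2 * i) = Inr (c i)"
    using snake_blocks_of_path_listing[OF assms(1) xs] .
  have "[c. Inr c \<leftarrow> xs] = map c [0..<k - 1]"
    by (rule cut_vertices_of_alternating_list[of _ _ B]) (use B assms(3) in auto)
  then have "d ! i = graph_dist G (c i) (c (Suc i))" if "i < k - 2" for i
    using that by (simp add: d nth_tl)
  with B(1) show thesis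
    using that by blast
qed

section \<open>Labels of edges and outer extensions\<close>

text \<open>The label induced on an edge \<open>e = {u, v}\<close>, as a function of the set \<open>e\<close>.\<close>

definition stretch :: "('a \<Rightarrow> int) \<Rightarrow> 'a set \<Rightarrow> int" where
  "stretch f e = Max (f ` e) - Min (f ` e)"

definition jumps :: "int list \<Rightarrow> int list" where
  "jumps hs = map (\<lambda>(a, b). \<bar>a - b\<bar>) (steps hs)"

lemma stretch_edge [simp]: "stretch f {u, v} = \<bar>f u - f v\<bar>"
  by (simp add: stretch_def)

lemma stretch_walk_edges: "stretch h ` walk_edges ws = set (jumps (map h ws))"
  by (force simp: walk_edges_def jumps_def steps_map image_image)

lemma labelling_of_list:
  assumes "distinct xs" "length xs = length ys"
  obtains h where "map h xs = ys"
proof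
  show "map (\<lambda>x. the (map_of (zip xs ys) x)) xs = ys"
    using assms by (intro nth_equalityI) (auto simp: map_of_zip_nth)
qed

text \<open>A graceful labelling in which the vertex \<open>z\<close>, where the graph is to be extended, has an
  extreme label.  By complementing the labels this can be taken to be \<open>0\<close>.\<close>

definition rooted_labelling ::
  "'a set \<Rightarrow> 'a set set \<Rightarrow> 'a \<Rightarrow> int \<Rightarrow> ('a \<Rightarrow> int) \<Rightarrow> bool" where
  "rooted_labelling V E z m f \<longleftrightarrow> z \<in> V \<and> f z = 0 \<and> 0 \<le> m \<and>
     inj_on f V \<and> f ` V \<subseteq> {0..m} \<and>
     (\<forall>e\<in>E. \<exists>u\<in>V. \<exists>v\<in>V. e = {u, v}) \<and> bij_betw (stretch f) E {1..m}"

definition outer_extension :: "'a set \<Rightarrow> int \<Rightarrow> ('a \<Rightarrow> int) \<Rightarrow> ('a \<Rightarrow> int) \<Rightarrow> 'a \<Rightarrow> int" where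
  "outer_extension V m f h v =
     (if v \<in> V then - f v else if h v < 0 then h v - m else h v)"

text \<open>The old labels, negated, fill part of \<open>{-m..0}\<close> and keep their differences.  The new labels
  lie outside this interval, which gives injectivity; each new edge joins the two sides of the
  interval, so moving the negative side down by \<open>m\<close> adds \<open>m\<close> to its label.\<close>

lemma outer_extension:
  assumes rl: "rooted_labelling V E z m f"
    and meet: "V \<inter> W = {z}"
    and h: "inj_on h W" "h z = 0"
    and F: "\<forall>e\<in>F. \<exists>u\<in>W. \<exists>v\<in>W. e = {u, v} \<and> 0 \<le> h u \<and> h v < 0"
    and D: "bij_betw (stretch h) F D"
  defines "f' \<equiv> outer_extension V m f h"
  shows "inj_on f' (V \<union> W)"
    and "bij_betw (stretch f') (E \<union> F) ({1..m} \<union> (+) m ` D)"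
    and "\<And>v. v \<in> W \<Longrightarrow> f' v = (if h v < 0 then h v - m else h v)"
    and "\<And>v. v \<in> V \<Longrightarrow> - m \<le> f' v \<and> f' v \<le> 0"
proof -
  have m: "0 \<le> m" and fz: "f z = 0" and f: "inj_on f V" "f ` V \<subseteq> {0..m}"
    and E: "\<And>e. e \<in> E \<Longrightarrow> \<exists>u\<in>V. \<exists>v\<in>V. e = {u, v}"
    and bij: "bij_betw (stretch f) E {1..m}"
    using rl by (auto simp: rooted_labelling_def)
  show onW: "f' v = (if h v < 0 then h v - m else h v)" if "v \<in> W" for v
  proof (cases "v \<in> V")
    case True
    with that meet have "v = z"
      by blast
    then show ?thesis
      using meet h(2) fz by (auto simp: f'_def outer_extension_def)
  qed (simp add: f'_def outer_extension_def)
  have onV: "f' v = - f v" if "v \<in> V" for v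
    using that by (simp add: f'_def outer_extension_def)
  show V_range: "- m \<le> f' v \<and> f' v \<le> 0" if "v \<in> V" for v
    using that f(2) by (force simp: onV)
  have W_range: "0 < f' v \<or> f' v < - m" if "v \<in> W - V" for v
  proof -
    have "h v \<noteq> 0"
      using inj_onD[OF h(1), of v z] h(2) meet that by auto
    then show ?thesis
      using that by (auto simp: onW)
  qed
  have "inj_on f' V"
    using f(1) by (auto simp: inj_on_def onV)
  moreover have "inj_on f' W"
    using h(1) m unfolding inj_on_def by (auto simp: onW split: if_splits)
  ultimately show "inj_on f' (V \<union> W)"
    unfolding inj_on_def
    by (metis DiffI UnE V_range W_range linorder_not_less)
  have bijE: "bij_betw (stretch f') E {1..m}"
  proof (rule iffD1[OF bij_betw_cong bij])
    fix e assume "e \<in> E"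
    then obtain u v where "u \<in> V" "v \<in> V" "e = {u, v}"
      using E by blast
    then show "stretch f e = stretch f' e"
      by (simp add: onV)
  qed
  have stretchF: "stretch f' e = m + stretch h e" if "e \<in> F" for e
    using bspec[OF F that] m by (auto simp: onW)
  have "bij_betw ((+) m \<circ> stretch h) F ((+) m ` D)"
    using D by (intro bij_betw_trans) (auto simp: bij_betw_def)
  then have bijF: "bij_betw (stretch f') F ((+) m ` D)"
    by (rule iffD1[OF bij_betw_cong, rotated]) (simp add: stretchF)
  have "0 < x" if "x \<in> D" for x
  proof -
    from that D obtain e where "e \<in> F" "x = stretch h e"
      by (auto simp: bij_betw_def)
    then show ?thesis
      using bspec[OF F, of e] by auto
  qed
  then have "{1..m} \<inter> (+) m ` D = {}"
    by force
  then show "bij_betw (stretch f') (E \<union> F) ({1..m} \<union> (+) m ` D)"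
    by (rule bij_betw_combine[OF bijE bijF])
qed

definition alternating :: "int list \<Rightarrow> bool" where
  "alternating hs \<longleftrightarrow> (\<forall>(a, b) \<in> set (steps hs). (a < 0) \<noteq> (b < 0))"

lemma alternating_edges:
  assumes "alternating (map h ws)" "e \<in> walk_edges ws"
  shows "\<exists>u\<in>set ws. \<exists>v\<in>set ws. e = {u, v} \<and> 0 \<le> h u \<and> h v < 0"
proof -
  obtain u v where e: "e = {u, v}" and uv: "(u, v) \<in> set (steps ws)" "u \<in> set ws" "v \<in> set ws"
    using assms(2) by (rule walk_edgesE)
  have "(h u < 0) \<noteq> (h v < 0)"
    using assms(1) uv(1) by (force simp: alternating_def steps_map)
  then show ?thesis
    using e uv by (metis insert_commute linorder_not_less)
qed

section \<open>Chains of ten-cycles\<close>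

text \<open>The lists \<open>hu\<close> and \<open>hw\<close> label two ten-cycles in cyclic order.  The first begins at the entry,
  the second at the vertex shared by both, which has index \<open>p\<close> in the first; the exit has
  index \<open>q\<close> in the second.\<close>

definition pair_labelling :: "nat \<Rightarrow> nat \<Rightarrow> int list \<Rightarrow> int list \<Rightarrow> bool" where
  "pair_labelling p q hu hw \<longleftrightarrow>
     length hu = 10 \<and> length hw = 10 \<and> p < 10 \<and> q < 10 \<and>
     hu ! 0 = 0 \<and> hw ! 0 = hu ! p \<and> \<bar>hw ! q\<bar> = 10 \<and>
     distinct (hu @ tl hw) \<and> set (hu @ hw) \<subseteq> {-10..10} \<and>
     alternating (closed_walk hu) \<and> alternating (closed_walk hw) \<and>
     set (jumps (closed_walk hu) @ jumps (closed_walk hw)) = {1..20}"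

definition distance_pairs :: "(nat \<times> nat) set" where
  "distance_pairs = {(p, q). p \<in> {2..5} \<and> q \<in> {p - 1, p}}"

text \<open>These tables were found by a computer search that places the edge labels from \<open>20\<close> downwards.\<close>

lemma pair_labellings:
  "pair_labelling 5 4 [0,-1,2,-7,8,-8,6,-5,5,-2] [-8,9,-9,10,-10,3,-3,1,-4,4]"
  "pair_labelling 5 5 [0,-3,5,-6,7,-8,4,-5,1,-1] [-8,8,-9,9,-10,10,-4,3,-2,2]"
  "pair_labelling 4 3 [0,-5,7,-8,9,-7,2,-2,1,-1] [9,-9,10,-10,4,-6,5,-3,3,-4]"
  "pair_labelling 4 4 [0,-1,4,-8,8,-7,3,-3,1,-2] [8,-9,9,-10,10,-4,5,-6,2,-5]"
  "pair_labelling 3 2 [0,-5,9,-9,8,-8,2,-2,1,-1] [-9,10,-10,5,-6,6,-3,3,-4,4]"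
  "pair_labelling 3 3 [0,-6,8,-9,7,-3,2,-2,1,-1] [-9,9,-10,10,-5,3,-4,5,-7,4]"
  "pair_labelling 2 1 [0,-5,10,-9,9,-8,2,-2,1,-1] [10,-10,6,-7,5,-6,3,-3,4,-4]"
  "pair_labelling 2 2 [0,-6,9,-9,7,-3,2,-2,1,-1] [9,-10,10,-7,5,-8,3,-4,4,-5]"
  by code_simp+

lemma pair_labelling_exists:
  assumes "(p, q) \<in> distance_pairs"
  shows "\<exists>hu hw. pair_labelling p q hu hw"
proof -
  from assms have "p = 2 \<or> p = 3 \<or> p = 4 \<or> p = 5" "q = p - 1 \<or> q = p"
    by (auto simp: distance_pairs_def)
  then have "(p, q) \<in> {(5,4), (5,5), (4,3), (4,4), (3,2), (3,3), (2,1), (2,2)}"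
    by auto
  then show ?thesis
    using pair_labellings by blast
qed

text \<open>After the outer extension all labels lie in \<open>{-m-10..10}\<close> and the exit has one of the two
  extreme values, which a translation or a reflection of the labels turns into \<open>0\<close>.\<close>

lemma attach_pair:
  assumes rl: "rooted_labelling V E (us ! 0) m f"
    and us: "distinct us" "length us = 10" "V \<inter> set us = {us ! 0}"
    and ws: "distinct ws" "length ws = 10" "(V \<union> set us) \<inter> set ws = {ws ! 0}"
    and pq: "(p, q) \<in> distance_pairs" and cut: "us ! p = ws ! 0"
  shows "\<exists>f'. rooted_labelling (V \<union> set us \<union> set ws) (E \<union> cycle_edges us \<union> cycle_edges ws)
            (ws ! q) (m + 20) f'"
proof -
  obtain hu hw where pl: "pair_labelling p q hu hw"
    using pair_labelling_exists[OF pq] by blast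
  then have len: "length hu = 10" "length hw = 10" and pq10: "p < 10" "q < 10"
    and hu0: "hu ! 0 = 0" and hwq: "\<bar>hw ! q\<bar> = 10" and hw0: "hw ! 0 = hu ! p"
    and dist: "distinct (hu @ tl hw)" and range: "set (hu @ hw) \<subseteq> {-10..10}"
    and alt: "alternating (closed_walk hu)" "alternating (closed_walk hw)"
    and jumps: "set (jumps (closed_walk hu) @ jumps (closed_walk hw)) = {1..20}"
    by (auto simp: pair_labelling_def)
  have ne: "us \<noteq> []" "ws \<noteq> []" "hw \<noteq> []"
    using us(2) ws(2) len by auto
  obtain w ws' where ws_Cons: "ws = w # ws'"
    using ne by (cases ws) auto
  have new: "set us \<inter> set (tl ws) = {}"
    using ws(1,3) by (auto simp: ws_Cons)
  have "ws ! 0 \<in> set us"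
    using cut pq10(1) us(2) by (metis nth_mem)
  then have W: "set (us @ tl ws) = set us \<union> set ws"
    by (auto simp: ws_Cons)
  have "distinct (us @ tl ws)" "length (us @ tl ws) = length (hu @ tl hw)"
    using us ws new len by (auto simp: distinct_tl)
  then obtain h where "map h (us @ tl ws) = hu @ tl hw"
    by (rule labelling_of_list)
  then have hu: "map h us = hu" and tl_hw: "map h (tl ws) = tl hw"
    using us(2) len by auto
  have "h (ws ! 0) = hw ! 0"
    using hu hw0 cut pq10(1) us(2) by (metis nth_map)
  then have hw: "map h ws = hw"
    using tl_hw ne by (cases hw) (auto simp: ws_Cons)
  let ?W = "set us \<union> set ws" and ?F = "cycle_edges us \<union> cycle_edges ws"
  have h0: "h (us ! 0) = 0"
    using hu hu0 us(2) by (metis nth_map zero_less_numeral)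
  have inj: "inj_on h ?W"
    unfolding W[symmetric] using dist \<open>map h (us @ tl ws) = hu @ tl hw\<close>
    by (metis distinct_map)
  have "x \<in> set us" if "x \<in> V" "x \<in> set ws" for x
  proof -
    have "x = ws ! 0"
      using ws(3) that by blast
    then show ?thesis
      using \<open>ws ! 0 \<in> set us\<close> by simp
  qed
  then have meet: "V \<inter> ?W = {us ! 0}"
    using us(3) by (auto simp del: nth_mem)
  have F: "\<forall>e\<in>?F. \<exists>u\<in>?W. \<exists>v\<in>?W. e = {u, v} \<and> 0 \<le> h u \<and> h v < 0"
    using alternating_edges[of h "closed_walk us"] alternating_edges[of h "closed_walk ws"] alt
    by (fastforce simp: closed_walk_map[symmetric] hu hw ne set_closed_walk)
  have "stretch h ` ?F = {1..20}"
    using jumps by (simp add: image_Un stretch_walk_edges closed_walk_map[symmetric] hu hw ne)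
  moreover have "card ?F \<le> 20"
    using card_Un_le[of "cycle_edges us" "cycle_edges ws"]
      card_walk_edges_le[of "closed_walk us"] card_walk_edges_le[of "closed_walk ws"] us(2) ws(2)
    by (simp add: closed_walk_def)
  moreover have "finite ?F"
    by (simp add: finite_walk_edges)
  ultimately have "inj_on (stretch h) ?F"
    using card_image_le[of ?F "stretch h"] by (intro eq_card_imp_inj_on) simp_all
  with \<open>stretch h ` ?F = {1..20}\<close> have bij: "bij_betw (stretch h) ?F {1..20}"
    by (simp add: bij_betw_def)
  define f1 where "f1 = outer_extension V m f h"
  note ext = outer_extension[OF rl meet inj h0 F bij, folded f1_def]
  have m: "0 \<le> m" and E: "\<forall>e\<in>E. \<exists>u\<in>V. \<exists>v\<in>V. e = {u, v}"
    using rl by (auto simp: rooted_labelling_def)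
  have h_range: "-10 \<le> h v \<and> h v \<le> 10" if "v \<in> ?W" for v
  proof -
    have "h ` ?W = set (hu @ hw)"
      using hu hw by (metis image_Un set_append set_map)
    then show ?thesis
      using range that by (metis (no_types) atLeastAtMost_iff imageI subsetD)
  qed
  have f1_range: "- m - 10 \<le> f1 v \<and> f1 v \<le> 10" if "v \<in> V \<union> ?W" for v
  proof (cases "v \<in> V")
    case True
    then show ?thesis
      using ext(4)[of v] by simp
  next
    case False
    then show ?thesis
      using ext(3)[of v] h_range[of v] that m by (simp split: if_splits)
  qed
  have bijm: "{1..m} \<union> (+) m ` {1..20} = {1..m + 20}"
    using m by (auto simp: image_add_atLeastAtMost)
  have edges: "\<forall>e\<in>E \<union> ?F. \<exists>u\<in>V \<union> ?W. \<exists>v\<in>V \<union> ?W. e = {u, v}"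
    using E F by (metis UnCI UnE)
  have hq: "h (ws ! q) = hw ! q" and q: "ws ! q \<in> ?W"
    using hw pq10(2) ws(2) by auto
  \<comment> \<open>The exit has the label \<open>- m - 10\<close> in the first case and \<open>10\<close> in the second.\<close>
  define f2 where "f2 v = (if hw ! q < 0 then f1 v + m + 10 else 10 - f1 v)" for v
  have stretch2: "stretch f2 e = stretch f1 e" if "e \<in> E \<union> ?F" for e
  proof -
    obtain u v where "e = {u, v}"
      using bspec[OF edges \<open>e \<in> E \<union> ?F\<close>] by (elim bexE)
    then show ?thesis
      by (simp add: f2_def abs_minus_commute)
  qed
  have "rooted_labelling (V \<union> ?W) (E \<union> ?F) (ws ! q) (m + 20) f2"
    unfolding rooted_labelling_def
  proof (intro conjI)
    show "f2 (ws ! q) = 0"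
      using ext(3)[OF q] hwq by (auto simp: f2_def hq)
    show "inj_on f2 (V \<union> ?W)"
      using ext(1) by (auto simp: inj_on_def f2_def)
    show "f2 ` (V \<union> ?W) \<subseteq> {0..m + 20}"
    proof
      fix y assume "y \<in> f2 ` (V \<union> ?W)"
      then obtain v where "v \<in> V \<union> ?W" "y = f2 v"
        by blast
      then show "y \<in> {0..m + 20}"
        using f1_range[of v] by (auto simp: f2_def)
    qed
    show "bij_betw (stretch f2) (E \<union> ?F) {1..m + 20}"
      using iffD2[OF bij_betw_cong[of "E \<union> ?F", OF stretch2] ext(2)] bijm by simp
  qed (use q m edges in auto)
  then show ?thesis
    by (metis Un_assoc)
qed

text \<open>A ten-cycle alone has no suitable labelling with edge labels \<open>{1..10}\<close>: the edge labels of a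
  closed walk have an even sum, whereas these add up to \<open>55\<close>.  With \<open>11\<close> in place of \<open>10\<close> the sum
  is \<open>56\<close> and a labelling exists.  Its values lie in \<open>{-7..4}\<close> and omit \<open>-6\<close>; after the reflection
  this gap becomes the omitted vertex label \<open>m + 10\<close>.\<close>

lemma attach_single:
  assumes rl: "rooted_labelling V E (us ! 0) m f"
    and us: "distinct us" "length us = 10" "V \<inter> set us = {us ! 0}"
  shows "\<exists>f'. inj_on f' (V \<union> set us) \<and> f' ` (V \<union> set us) \<subseteq> {0..m + 11} - {m + 10} \<and>
            bij_betw (stretch f') (E \<union> cycle_edges us) ({1..m + 9} \<union> {m + 11})"
proof -
  define hu :: "int list" where "hu = [0,-1,1,-2,2,-3,3,-5,4,-7]"
  have "length us = length hu"
    by (simp add: us hu_def)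
  then obtain h where hu: "map h us = hu"
    using labelling_of_list us(1) by blast
  let ?W = "set us" and ?F = "cycle_edges us"
  have ne: "us \<noteq> []"
    using us(2) by auto
  have h0: "h (us ! 0) = 0"
    using hu us(2) by (metis nth_map zero_less_numeral nth_Cons_0 hu_def)
  have "distinct hu"
    by (simp add: hu_def)
  then have inj: "inj_on h ?W"
    using hu by (metis distinct_map)
  have "alternating (closed_walk hu)"
    unfolding hu_def by code_simp
  then have F: "\<forall>e\<in>?F. \<exists>u\<in>?W. \<exists>v\<in>?W. e = {u, v} \<and> 0 \<le> h u \<and> h v < 0"
    using alternating_edges[of h "closed_walk us"]
    by (auto simp: closed_walk_map[symmetric] hu ne set_closed_walk)
  have "set (jumps (closed_walk hu)) = {1..9} \<union> {11}"
    unfolding hu_def by code_simp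
  then have image: "stretch h ` ?F = {1..9} \<union> {11}"
    by (simp add: stretch_walk_edges closed_walk_map[symmetric] hu ne)
  moreover have "card ?F \<le> 10"
    using card_walk_edges_le[of "closed_walk us"] us(2) by (simp add: closed_walk_def)
  moreover have "finite ?F"
    by (simp add: finite_walk_edges)
  ultimately have "inj_on (stretch h) ?F"
    using card_image_le[of ?F "stretch h"] by (intro eq_card_imp_inj_on) simp_all
  with image have bij: "bij_betw (stretch h) ?F ({1..9} \<union> {11})"
    by (simp add: bij_betw_def)
  define f1 where "f1 = outer_extension V m f h"
  note ext = outer_extension[OF rl us(3) inj h0 F bij, folded f1_def]
  have m: "0 \<le> m" and E: "\<forall>e\<in>E. \<exists>u\<in>V. \<exists>v\<in>V. e = {u, v}"
    using rl by (auto simp: rooted_labelling_def)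
  have h_range: "-7 \<le> h v \<and> h v \<le> 4 \<and> h v \<noteq> -6" if "v \<in> ?W" for v
  proof -
    have "h v \<in> set hu"
      using hu that by (metis imageI set_map)
    then show ?thesis
      by (auto simp: hu_def)
  qed
  have f1_range: "- m - 7 \<le> f1 v \<and> f1 v \<le> 4 \<and> f1 v \<noteq> - m - 6" if "v \<in> V \<union> ?W" for v
  proof (cases "v \<in> V")
    case True
    then show ?thesis
      using ext(4)[of v] by simp
  next
    case False
    then show ?thesis
      using ext(3)[of v] h_range[of v] that m by (simp split: if_splits)
  qed
  have bijm: "{1..m} \<union> (+) m ` ({1..9} \<union> {11}) = {1..m + 9} \<union> {m + 11}"
    using m by (auto simp: image_add_atLeastAtMost)
  have edges: "\<forall>e\<in>E \<union> ?F. \<exists>u\<in>V \<union> ?W. \<exists>v\<in>V \<union> ?W. e = {u, v}"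
    using E F by (metis UnCI UnE)
  define f2 where "f2 v = 4 - f1 v" for v
  have stretch2: "stretch f2 e = stretch f1 e" if "e \<in> E \<union> ?F" for e
  proof -
    obtain u v where "e = {u, v}"
      using bspec[OF edges \<open>e \<in> E \<union> ?F\<close>] by (elim bexE)
    then show ?thesis
      by (simp add: f2_def abs_minus_commute)
  qed
  have "inj_on f2 (V \<union> ?W)"
    using ext(1) by (auto simp: inj_on_def f2_def)
  moreover have "f2 ` (V \<union> ?W) \<subseteq> {0..m + 11} - {m + 10}"
  proof
    fix y assume "y \<in> f2 ` (V \<union> ?W)"
    then obtain v where "v \<in> V \<union> ?W" "y = f2 v"
      by blast
    then show "y \<in> {0..m + 11} - {m + 10}"
      using f1_range[of v] by (auto simp: f2_def)
  qed
  moreover have "bij_betw (stretch f2) (E \<union> ?F) ({1..m + 9} \<union> {m + 11})"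
    using iffD2[OF bij_betw_cong[of "E \<union> ?F", OF stretch2] ext(2)] bijm by simp
  ultimately show ?thesis
    by blast
qed

text \<open>The cycles are attached two at a time, starting from a single vertex with the label \<open>0\<close>; an
  odd chain leaves one cycle for the end.\<close>

lemma chain_of_cycles_labelling:
  assumes k: "1 \<le> k"
    and G: "verts G = (\<Union>j<k. set (vs j))" "edges G = (\<Union>j<k. cycle_edges (vs j))"
    and vs: "\<And>j. j < k \<Longrightarrow> distinct (vs j) \<and> length (vs j) = 10"
    and link: "\<And>j. Suc j < k \<Longrightarrow> vs j ! p j = vs (Suc j) ! 0"
    and meet: "\<And>j. 0 < j \<Longrightarrow> j < k \<Longrightarrow> (\<Union>i<j. set (vs i)) \<inter> set (vs j) = {vs j ! 0}"
    and p: "\<And>i. 2 * i + 1 < k \<Longrightarrow> (p (2 * i), p (2 * i + 1)) \<in> distance_pairs"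
  shows "(even k \<longrightarrow> graceful G) \<and> (odd k \<longrightarrow> near_graceful G)"
proof -
  \<comment> \<open>The inserted vertex is the starting graph; it matters only for \<open>n = 0\<close>.\<close>
  define V where "V n = insert (vs 0 ! 0) (\<Union>j<n. set (vs j))" for n
  define E where "E n = (\<Union>j<n. cycle_edges (vs j))" for n
  have V_Suc: "V (Suc n) = V n \<union> set (vs n)" and E_Suc: "E (Suc n) = E n \<union> cycle_edges (vs n)" for n
    by (auto simp: V_def E_def lessThan_Suc)
  have first: "vs 0 ! 0 \<in> set (vs 0)"
    using vs[of 0] k by auto
  have V: "V n = (\<Union>j<n. set (vs j))" if "0 < n" for n
    using that first unfolding V_def by blast
  have V_meet: "V j \<inter> set (vs j) = {vs j ! 0}" if "j < k" for j
  proof (cases "j = 0")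
    case True
    then show ?thesis
      using first by (simp add: V_def)
  next
    case False
    then show ?thesis
      using meet[of j] that V[of j] by simp
  qed
  have pairs: "\<exists>z f. rooted_labelling (V (2 * n)) (E (2 * n)) z (20 * int n) f \<and>
      (2 * n < k \<longrightarrow> z = vs (2 * n) ! 0)" if "2 * n \<le> k" for n
    using that
  proof (induction n)
    case 0
    have "rooted_labelling (V 0) (E 0) (vs 0 ! 0) 0 (\<lambda>_. 0)"
      by (simp add: rooted_labelling_def V_def E_def bij_betw_def)
    then show ?case
      by auto
  next
    case (Suc n)
    let ?j = "2 * n"
    have j: "?j < k" "Suc ?j < k"
      using Suc.prems by auto
    obtain f where f: "rooted_labelling (V ?j) (E ?j) (vs ?j ! 0) (20 * int n) f"
      using Suc j by auto
    have "\<exists>f'. rooted_labelling (V ?j \<union> set (vs ?j) \<union> set (vs (Suc ?j)))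
        (E ?j \<union> cycle_edges (vs ?j) \<union> cycle_edges (vs (Suc ?j)))
        (vs (Suc ?j) ! p (Suc ?j)) (20 * int n + 20) f'"
      using vs[of ?j] vs[of "Suc ?j"] V_meet[of ?j] V_meet[of "Suc ?j"] j p[of n] link[of ?j]
      by (intro attach_pair[OF f, where p = "p ?j"]) (simp_all add: V_Suc)
    then show ?case
      using link[of "Suc ?j"] by (auto simp: V_Suc E_Suc algebra_simps)
  qed
  have GV: "verts G = V k" and GE: "edges G = E k"
    using G V[of k] k by (auto simp: E_def)
  have ind: "induced_edge_labelling G f (stretch f)" for f
    by (simp add: induced_edge_labelling_def)
  show ?thesis
  proof (intro conjI impI)
    assume "even k"
    then obtain n where n: "k = 2 * n"
      by auto
    then obtain z f where f: "rooted_labelling (V k) (E k) z (20 * int n) f"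
      using pairs[of n] by auto
    then have "bij_betw (stretch f) (E k) {1..20 * int n}"
      by (simp add: rooted_labelling_def)
    then have "card (E k) = card {1..20 * int n}"
      by (rule bij_betw_same_card)
    then have "graceful_labelling G f"
      using f ind[of f] unfolding graceful_labelling_def rooted_labelling_def
      by (auto simp: GV GE Let_def)
    then show "graceful G"
      by (auto simp: graceful_def)
  next
    assume "odd k"
    then obtain n where n: "k = Suc (2 * n)"
      by (auto elim: oddE)
    let ?m = "20 * int n"
    obtain f where f: "rooted_labelling (V (2 * n)) (E (2 * n)) (vs (2 * n) ! 0) ?m f"
      using pairs[of n] n by auto
    have "\<exists>f'. inj_on f' (V k) \<and> f' ` V k \<subseteq> {0..?m + 11} - {?m + 10} \<and>
        bij_betw (stretch f') (E k) ({1..?m + 9} \<union> {?m + 11})"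
      using attach_single[OF f] vs[of "2 * n"] V_meet[of "2 * n"] by (simp add: n V_Suc E_Suc)
    then obtain f' where inj: "inj_on f' (V k)" and ran: "f' ` V k \<subseteq> {0..?m + 11} - {?m + 10}"
      and bij: "bij_betw (stretch f') (E k) ({1..?m + 9} \<union> {?m + 11})"
      by blast
    have "card (E k) = card ({1..?m + 9} \<union> {?m + 11})"
      using bij by (rule bij_betw_same_card)
    then have card: "int (card (edges G)) = ?m + 10"
      by (simp add: GE)
    have "near_graceful_labelling G f'"
      unfolding near_graceful_labelling_def Let_def card
    proof (intro conjI exI)
      show "{1..?m + 10 - 1} \<union> {?m + 10 + 1} \<in> {{1..?m + 10}, {1..?m + 10 - 1} \<union> {?m + 10 + 1}}"
        by blast
    qed (use inj ran bij ind[of f'] in \<open>auto simp: GV GE add.commute\<close>)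
    moreover have "omits_m G f'"
      unfolding omits_m_def Let_def card
    proof (intro conjI allI impI)
      show "?m + 10 \<notin> f' ` verts G"
        using ran by (auto simp: GV)
      fix u v assume "{u, v} \<in> edges G"
      then have "stretch f' {u, v} \<in> {1..?m + 9} \<union> {?m + 11}"
        using bij by (metis GE bij_betwE)
      then show "\<bar>f' u - f' v\<bar> \<noteq> ?m + 10"
        by auto
    qed
    ultimately show "near_graceful G"
      by (auto simp: near_graceful_def)
  qed
qed

section \<open>Distances along a snake\<close>

text \<open>A walk from \<open>ws ! 0\<close> to \<open>ws ! p\<close> raises the potential \<open>\<phi>\<close> by \<open>p\<close>, but each of its steps by
  at most one.\<close>

lemma graph_dist_eqI:
  assumes walk: "walk_edges ws \<subseteq> edges G" "p < length ws"
    and lipschitz: "\<And>u v. {u, v} \<in> edges G \<Longrightarrow> \<phi> v \<le> \<phi> u + (1 :: int)"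
    and ends: "\<phi> (ws ! p) = \<phi> (ws ! 0) + int p"
  shows "graph_dist G (ws ! 0) (ws ! p) = p"
  unfolding graph_dist_def
proof (rule Least_equality)
  have "(ws ! i, ws ! Suc i) \<in> adj G" if "i < p" for i
  proof -
    have "{ws ! i, ws ! Suc i} \<in> walk_edges ws"
      unfolding walk_edges_nth using that walk(2) by (intro CollectI exI[of _ i]) simp
    then show ?thesis
      using walk(1) by auto
  qed
  then show "(ws ! 0, ws ! p) \<in> adj G ^^ p"
    unfolding relpow_fun_conv by (intro exI[of _ "\<lambda>i. ws ! i"]) simp
  have le: "\<phi> v \<le> \<phi> u + int n" if "(u, v) \<in> adj G ^^ n" for u v n
    using that
  proof (induction n arbitrary: v)
    case (Suc n)
    then obtain y where "(u, y) \<in> adj G ^^ n" "{y, v} \<in> edges G"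
      by auto
    then show ?case
      using Suc.IH[of y] lipschitz[of y v] by simp
  qed simp
  show "p \<le> n" if "(ws ! 0, ws ! p) \<in> adj G ^^ n" for n
    using le[OF that] ends by simp
qed

text \<open>The potential is the cyclic distance from \<open>us ! 0\<close> on the block \<open>B j\<close>.  It extends to the
  earlier blocks by the constant \<open>0\<close> and to the later ones by the constant \<open>p\<close>, because these meet
  \<open>B j\<close> only in its two cut vertices.\<close>

lemma snake_block_distance:
  assumes sb: "snake_blocks k B c G" and G: "simple_graph G"
    and j: "0 < j" "Suc j < k"
    and us: "cycle_listing (B j) us" "us ! 0 = c (j - 1)" "p \<le> 5" "us ! p = c j"
  shows "graph_dist G (c (j - 1)) (c j) = p"
proof -
  have blocks: "blocks G = B ` {..<k}"
    and meet: "\<And>i j x. \<lbrakk>i < j; j < k; x \<in> verts (B i); x \<in> verts (B j)\<rbrakk> \<Longrightarrow> j = Suc i \<and> x = c i"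
    using sb by (auto simp: snake_blocks_def)
  have len: "length us = 10" and "distinct us" and E: "edges (B j) = cycle_edges us"
    using us(1) by (auto simp: cycle_listing_def)
  then obtain \<psi> :: "'a \<Rightarrow> int" where \<psi>: "map \<psi> us = [0,1,2,3,4,5,4,3,2,1]"
    using labelling_of_list[of us "[0,1,2,3,4,5,4,3,2,1] :: int list"] by auto
  have "stretch \<psi> ` cycle_edges us = {1}"
    using len \<psi> by (simp add: stretch_walk_edges closed_walk_map[symmetric] flip: length_0_conv)
      (simp add: closed_walk_def jumps_def steps_def)
  then have lip: "\<psi> v \<le> \<psi> u + 1" if "{u, v} \<in> edges (B j)" for u v
    using that E
    by (metis abs_le_D1 abs_minus_commute add.commute diff_le_eq imageI order_refl singletonD
        stretch_edge)
  have \<psi>_nth: "\<psi> (us ! i) = int i" if "i \<le> 5" for i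
  proof -
    have "\<psi> (us ! i) = map \<psi> us ! i"
      using that len by simp
    moreover have "i \<in> {0, 1, 2, 3, 4, 5}"
      using that by auto
    ultimately show ?thesis
      unfolding \<psi> by auto
  qed
  define \<phi> where "\<phi> v = (if v \<in> verts (B j) then \<psi> v
      else if \<exists>i<j. v \<in> verts (B i) then 0 else int p)" for v
  have before: "\<phi> v = 0" if v: "v \<in> verts (B i)" "i < j" for v i
    using meet[of i j v] v j us(2) \<psi>_nth[of 0] by (auto simp: \<phi>_def)
  have after: "\<phi> v = int p" if v: "v \<in> verts (B i)" "j < i" "i < k" for v i
  proof (cases "v \<in> verts (B j)")
    case True
    then have "v = us ! p"
      using meet[of j i v] v us(4) by simp
    then show ?thesis
      using True us(3) \<psi>_nth[of p] by (simp add: \<phi>_def)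
  next
    case False
    have "v \<notin> verts (B i')" if "i' < j" for i'
      using meet[of i' i v] v that by auto
    with False show ?thesis
      by (auto simp: \<phi>_def)
  qed
  have "\<phi> v \<le> \<phi> u + 1" if uv: "{u, v} \<in> edges G" for u v
  proof -
    obtain K where K: "K \<in> blocks G" "{u, v} \<in> edges K" "u \<in> verts K" "v \<in> verts K"
      using edge_in_block[OF G uv] .
    then obtain i where i: "i < k" "K = B i"
      using blocks by auto
    consider "i < j" | "i = j" | "j < i"
      by linarith
    then show ?thesis
    proof cases
      case 2
      then show ?thesis
        using K i lip by (simp add: \<phi>_def)
    qed (use K i before after in simp_all)
  qed
  moreover have "edges (B j) \<subseteq> edges G"
    using blocks j by (auto simp: blocks_def subgraph_def)
  moreover have "\<phi> (us ! 0) = 0" "\<phi> (us ! p) = int p"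
    using us(1,3) len \<psi>_nth[of 0] \<psi>_nth[of p] by (simp_all add: \<phi>_def cycle_listing_def)
  ultimately have "graph_dist G (closed_walk us ! 0) (closed_walk us ! p) = p"
    using E us(3) len by (intro graph_dist_eqI[where \<phi> = \<phi>]) (auto simp: closed_walk_def nth_append)
  then show ?thesis
    using us len by (simp add: closed_walk_def nth_append)
qed

section \<open>Graceful labellings of cyclic snakes\<close>

text \<open>The distance \<open>d ! (j - 1)\<close> is measured inside block number \<open>j\<close>, counting from \<open>0\<close>.  Pairing
  the blocks as \<open>(0, 1)\<close>, \<open>(2, 3)\<close>, ... therefore puts a fixed distance first and a free one second
  in each pair.  The end blocks contain only one cut vertex, and there the distance \<open>s\<close> is chosen.\<close>

lemma cyclic_snake_labelling:
  assumes k: "1 \<le> k" and snake: "cyclic_snake k 10 G" and string: "snake_string G d"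
    and s: "s \<in> {2..5}"
    and d: "\<And>i. 1 \<le> i \<Longrightarrow> i \<le> k - 2 \<Longrightarrow>
      (odd i \<longrightarrow> d ! (i - 1) \<in> {s - 1, s}) \<and> (even i \<longrightarrow> d ! (i - 1) = s)"
  shows "(even k \<longrightarrow> graceful G) \<and> (odd k \<longrightarrow> near_graceful G)"
proof -
  have G: "simple_graph G" and cyc: "\<And>B. B \<in> blocks G \<Longrightarrow> is_cycle 10 B"
    using snake by (auto simp: cyclic_snake_def)
  obtain B c where sb: "snake_blocks k B c G"
    and dist: "\<forall>i<k - 2. d ! i = graph_dist G (c i) (c (Suc i))"
    using snake_string_blocks[OF snake string k] .
  then have blocks: "blocks G = B ` {..<k}"
    and c: "\<And>i. Suc i < k \<Longrightarrow> c i \<in> verts (B i) \<and> c i \<in> verts (B (Suc i))"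
    and meet: "\<And>i j x. \<lbrakk>i < j; j < k; x \<in> verts (B i); x \<in> verts (B j)\<rbrakk> \<Longrightarrow> j = Suc i \<and> x = c i"
    by (auto simp: snake_blocks_def)
  define p where "p j = (if 0 < j \<and> Suc j < k then d ! (j - 1) else s)" for j
  have "\<exists>us. cycle_listing (B j) us \<and> (0 < j \<longrightarrow> us ! 0 = c (j - 1)) \<and>
      (Suc j < k \<longrightarrow> us ! p j = c j)" if j: "j < k" for j
  proof -
    have "is_cycle 10 (B j)"
      using cyc blocks j by simp
    then obtain us where us: "cycle_listing (B j) us"
      by (rule is_cycle_listing)
    have pred: "c (j - 1) \<in> verts (B j)" if "0 < j"
      using c[of "j - 1"] that \<open>j < k\<close> by simp
    consider "0 < j" "Suc j < k" | "0 < j" "Suc j = k" | "j = 0" "Suc j < k" | "j = 0" "Suc j = k"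
      using j by linarith
    then show ?thesis
    proof cases
      case 1
      obtain vs q where vs: "cycle_listing (B j) vs" "vs ! 0 = c (j - 1)" "q \<le> 5" "vs ! q = c j"
        using cycle_listing_from_to[OF us pred[OF 1(1)] conjunct1[OF c[OF 1(2)]]] .
      then have "p j = q"
        using snake_block_distance[OF sb G 1 vs] dist[rule_format, of "j - 1"] 1 by (simp add: p_def)
      then show ?thesis
        using vs by blast
    next
      case 2
      then show ?thesis
        using cycle_listing_from_to[OF us pred pred] 2 by (metis less_irrefl)
    next
      case 3
      have "c j \<in> verts (B j)"
        using c 3 by blast
      from cycle_listing_from_to[OF us this this]
      obtain vs where vs: "cycle_listing (B j) vs" "vs ! 0 = c j"
        by metis
      \<comment> \<open>The chain starts at the vertex that puts \<open>c 0\<close> at position \<open>s\<close> of the first block.\<close>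
      have "cycle_listing (B j) (rotate (10 - s) vs)"
        using vs by (simp add: cycle_listing_def cycle_edges_rotate)
      moreover have "rotate (10 - s) vs ! s = c j"
        using vs s by (simp add: nth_rotate cycle_listing_def)
      ultimately show ?thesis
        using 3 by (auto simp: p_def)
    next
      case 4
      then show ?thesis
        using us by auto
    qed
  qed
  then obtain vs where vs: "\<And>j. j < k \<Longrightarrow> cycle_listing (B j) (vs j)"
    "\<And>j. j < k \<Longrightarrow> 0 < j \<Longrightarrow> vs j ! 0 = c (j - 1)" "\<And>j. Suc j < k \<Longrightarrow> vs j ! p j = c j"
    by (metis Suc_lessD)
  show ?thesis
  proof (rule chain_of_cycles_labelling[OF k, of G vs p])
    show "verts G = (\<Union>j<k. set (vs j))" "edges G = (\<Union>j<k. cycle_edges (vs j))"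
      unfolding union_of_blocks[OF G] blocks using vs(1) by (auto simp: cycle_listing_def)
    show "distinct (vs j) \<and> length (vs j) = 10" if "j < k" for j
      using vs(1)[OF that] by (simp add: cycle_listing_def)
    show "vs j ! p j = vs (Suc j) ! 0" if "Suc j < k" for j
      using vs that by simp
    show "(\<Union>i<j. set (vs i)) \<inter> set (vs j) = {vs j ! 0}" if j: "0 < j" "j < k" for j
    proof -
      have V: "set (vs i) = verts (B i)" if "i \<le> j" for i
        using vs(1)[of i] that j by (simp add: cycle_listing_def)
      have "x = c (j - 1)" if "i < j" "x \<in> verts (B i)" "x \<in> verts (B j)" for i x
        using meet[of i j x] that j by simp
      moreover have "c (j - 1) \<in> verts (B (j - 1)) \<and> c (j - 1) \<in> verts (B j)"
        using c[of "j - 1"] j by simp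
      moreover have "j - 1 < j" "vs j ! 0 = c (j - 1)"
        using j vs(2) by auto
      ultimately show ?thesis
        using V by auto
    qed
    show "(p (2 * i), p (2 * i + 1)) \<in> distance_pairs" if i: "2 * i + 1 < k" for i
    proof -
      have "p (2 * i) = s"
        using d[of "2 * i"] i by (auto simp: p_def)
      moreover have "p (2 * i + 1) \<in> {s - 1, s}"
        using d[of "2 * i + 1"] i by (auto simp: p_def)
      ultimately show ?thesis
        using s unfolding distance_pairs_def mem_Collect_eq prod.case by simp
    qed
  qed
qed

theorem theorem3p2:
  fixes G :: "'a ugraph" and k :: nat and d :: "nat list"
  assumes "1 \<le> k"
    and "cyclic_snake k 10 G"
    and "snake_string G d"
    and "(\<forall>i. 1 \<le> i \<and> i \<le> k - 2 \<longrightarrow>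
             (odd i \<longrightarrow> d ! (i - 1) \<in> {4, 5}) \<and> (even i \<longrightarrow> d ! (i - 1) = 5)) \<or>
         (\<forall>i. 1 \<le> i \<and> i \<le> k - 2 \<longrightarrow>
             (odd i \<longrightarrow> d ! (i - 1) \<in> {3, 4}) \<and> (even i \<longrightarrow> d ! (i - 1) = 4)) \<or>
         (\<forall>i. 1 \<le> i \<and> i \<le> k - 2 \<longrightarrow>
             (odd i \<longrightarrow> d ! (i - 1) \<in> {2, 3}) \<and> (even i \<longrightarrow> d ! (i - 1) = 3)) \<or>
         (\<forall>i. 1 \<le> i \<and> i \<le> k - 2 \<longrightarrow>
             (odd i \<longrightarrow> d ! (i - 1) \<in> {1, 2}) \<and> (even i \<longrightarrow> d ! (i - 1) = 2))"
  shows "(even k \<longrightarrow> graceful G) \<and> (odd k \<longrightarrow> near_graceful G)"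
  using assms(4)
proof (elim disjE)
qed (use cyclic_snake_labelling[OF assms(1-3), of 5] cyclic_snake_labelling[OF assms(1-3), of 4]
    cyclic_snake_labelling[OF assms(1-3), of 3] cyclic_snake_labelling[OF assms(1-3), of 2]
    in simp_all)

end
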